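(* Let $\kappa\neq 0$, $n\ge 2$, $m_1,\dots,m_n>0$, and let $0<t^*<\infty$. Assume that $(\mathbf q,\mathbf p)$ is an analytic solution, defined on $[0,t^* )$, of the equations of motion of the curved $n$-body problem on $\mathbf M^2_\kappa$, and that, if $\kappa>0$, this solution is bounded away from collision-antipodal configurations. If $$\lim_{t\to t^*}\ \min_{1\le i<j\le n}\big|\kappa\,\mathbf q_i(t)\odot\mathbf q_j(t)-1\big|=0,$$ then $t^*$ is a singularity of the solution.
   Context: Let $\sigma=+1$ if $\kappa>0$ and $\sigma=-1$ if $\kappa<0$. For $\mathbf a=(a_x,a_y,a_z)$, $\mathbf b=(b_x,b_y,b_z)$ in $\mathbb R^3$ put $\mathbf a\odot\mathbf b=a_xb_x+a_yb_y+\sigma a_zb_z$. Let $\mathbf M^2_\kappa=\{(x,y,z)\in\mathbb R^3: \kappa(x^2+y^2+\sigma z^2)=1\}$; this is a sphere for $\kappa>0$, and for $\kappa<0$ only the upper sheet $z>0$ of the hyperboloid is taken. The bodies of masses $m_i$ have positions $\mathbf q_i=(x_i,y_i,z_i)\in\mathbf M^2_\kappa$ and momenta $\mathbf p_i$, $\mathbf q=(\mathbf q_1,\dots,\mathbf q_n)$, $\mathbf p=(\mathbf p_1,\dots,\mathbf p_n)$, subject to $\kappa\,\mathbf q_i\odot\mathbf q_i=1$ and $\mathbf q_i\odot\mathbf p_i=0$ for all $i$. The equations of motion are $$\dot{\mathbf q}_i=m_i^{-1}\mathbf p_i,\qquad \dot{\mathbf p}_i=\bar\nabla_{\mathbf q_i}U_\kappa(\mathbf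 q)-m_i^{-1}\kappa(\mathbf p_i\odot\mathbf p_i)\mathbf q_i,\qquad i=1,\dots,n,$$ where $$\bar\nabla_{\mathbf q_i}U_\kappa(\mathbf q)=\sum_{j\ne i}\frac{m_im_j(\sigma\kappa)^{3/2}(\kappa\mathbf q_j\odot\mathbf q_j)[(\kappa\mathbf q_i\odot\mathbf q_i)\mathbf q_j-(\kappa\mathbf q_i\odot\mathbf q_j)\mathbf q_i]}{[\sigma(\kappa\mathbf q_i\odot\mathbf q_i)(\kappa\mathbf q_j\odot\mathbf q_j)-\sigma(\kappa\mathbf q_i\odot\mathbf q_j)^2]^{3/2}}.$$ The equations are undefined on $\mathbf\Delta=\mathbf\Delta^+\cup\mathbf\Delta^-$, where $\mathbf\Delta^{\pm}$ is the set of configurations in $(\mathbf M^2_\kappa)^n$ with $\kappa\mathbf q_i\odot\mathbf q_j=\pm1$ for some $i<j$ ($\mathbf\Delta^+$: collisions; $\mathbf\Delta^-$: antipodal configurations, which exist only for $\kappa>0$). A solution on $[0,t^* )$ satisfies $\mathbf q(t)\notin\mathbf\Delta$ for $t\in[0,t^* )$. A collision-antipodal configuration is one that is both a collision and an antipodal configuration, i.e. an element of $\mathbf\Delta^+\cap\mathbf\Delta^-$; the solution is bounded away from such configurations if there is $\varepsilon>0$ such that the Euclidean distance from $\mathbf q(t)$ to $\mathbf\Delta^+\cap\mathbf\Delta^-$ is at least $\varepsilon$ for all $t\in[0,t^* )$ (vacuous if this set is empty). A finite time $t^*$ is a singularity of a solution defined on $[0,t^* )$ if the solution cannot be extended analytically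 to an interval $[0,t')$ with $t'>t^*$. *)

theory Defs
  imports "HOL-Analysis.Analysis"
begin

text \<open>
  The bodies are indexed by a finite type \<open>'n\<close>, so a configuration is an element of
  \<open>(real^3)^'n\<close>, whose library metric is the Euclidean one on \<open>3 * CARD('n)\<close> coordinates.
  All pair conditions below are symmetric, so unordered pairs \<open>i < j\<close> are rendered by \<open>i \<noteq> j\<close>.
\<close>

type_synonym 'n config = "(real^3)^'n"

definition odot :: "real \<Rightarrow> real^3 \<Rightarrow> real^3 \<Rightarrow> real" where
  "odot \<kappa> a b = a$1 * b$1 + a$2 * b$2 + sgn \<kappa> * (a$3 * b$3)"

definition M2 :: "real \<Rightarrow> (real^3) set" where
  "M2 \<kappa> = {v. \<kappa> * odot \<kappa> v v = 1 \<and> (\<kappa> < 0 \<longrightarrow> v$3 > 0)}"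

definition Delta_plus :: "real \<Rightarrow> ('n::finite) config set" where
  "Delta_plus \<kappa> = {q. (\<forall>i. q$i \<in> M2 \<kappa>) \<and> (\<exists>i j. i \<noteq> j \<and> \<kappa> * odot \<kappa> (q$i) (q$j) = 1)}"

definition Delta_minus :: "real \<Rightarrow> ('n::finite) config set" where
  "Delta_minus \<kappa> = {q. (\<forall>i. q$i \<in> M2 \<kappa>) \<and> (\<exists>i j. i \<noteq> j \<and> \<kappa> * odot \<kappa> (q$i) (q$j) = -1)}"

definition grad_U :: "real \<Rightarrow> ('n::finite \<Rightarrow> real) \<Rightarrow> 'n config \<Rightarrow> 'n \<Rightarrow> real^3" where
  "grad_U \<kappa> m q i =
    (\<Sum>j\<in>UNIV - {i}.
      (m i * m j * (sgn \<kappa> * \<kappa>) powr (3/2) * (\<kappa> * odot \<kappa> (q$j) (q$j))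
        / (sgn \<kappa> * (\<kappa> * odot \<kappa> (q$i) (q$i)) * (\<kappa> * odot \<kappa> (q$j) (q$j))
            - sgn \<kappa> * (\<kappa> * odot \<kappa> (q$i) (q$j))^2) powr (3/2))
      *\<^sub>R ((\<kappa> * odot \<kappa> (q$i) (q$i)) *\<^sub>R q$j - (\<kappa> * odot \<kappa> (q$i) (q$j)) *\<^sub>R q$i))"

text \<open>
  Real analyticity of a function on a set: locally the sum of a power series. The expansion is
  required only at points of the set, so at the left end of \<open>{0..<T}\<close> it is one-sided and the
  values of \<open>f\<close> outside the set play no role.
\<close>

definition real_analytic_on :: "(real \<Rightarrow> 'a::real_normed_vector) \<Rightarrow> real set \<Rightarrow> bool" where
  "real_analytic_on f S \<longleftrightarrow>
    (\<forall>t\<in>S. \<exists>r>0. \<exists>a :: nat \<Rightarrow> 'a.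
      \<forall>s\<in>S. \<bar>s - t\<bar> < r \<longrightarrow> (\<lambda>k. (s - t)^k *\<^sub>R a k) sums f s)"

definition solution_on ::
  "real \<Rightarrow> ('n::finite \<Rightarrow> real) \<Rightarrow> (real \<Rightarrow> 'n config) \<Rightarrow> (real \<Rightarrow> 'n config) \<Rightarrow> real set \<Rightarrow> bool" where
  "solution_on \<kappa> m q p S \<longleftrightarrow>
    (\<forall>t\<in>S.
      (\<forall>i. q t $ i \<in> M2 \<kappa> \<and> odot \<kappa> (q t $ i) (p t $ i) = 0) \<and>
      q t \<notin> Delta_plus \<kappa> \<union> Delta_minus \<kappa> \<and>
      (\<forall>i. ((\<lambda>s. q s $ i) has_vector_derivative inverse (m i) *\<^sub>R p t $ i) (at t within S) \<and>
           ((\<lambda>s. p s $ i) has_vector_derivative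
              grad_U \<kappa> m (q t) i
              - (inverse (m i) * \<kappa> * odot \<kappa> (p t $ i) (p t $ i)) *\<^sub>R q t $ i) (at t within S)))"

definition analytic_solution_on ::
  "real \<Rightarrow> ('n::finite \<Rightarrow> real) \<Rightarrow> (real \<Rightarrow> 'n config) \<Rightarrow> (real \<Rightarrow> 'n config) \<Rightarrow> real set \<Rightarrow> bool" where
  "analytic_solution_on \<kappa> m q p S \<longleftrightarrow>
    solution_on \<kappa> m q p S \<and> real_analytic_on q S \<and> real_analytic_on p S"

text \<open>
  Written with a quantifier rather than \<^const>\<open>infdist\<close>, which is \<open>0\<close> for the empty set,
  so that the condition is vacuous when there are no collision-antipodal configurations.
\<close>

definition bounded_away_from_collision_antipodal ::
  "real \<Rightarrow> (real \<Rightarrow> ('n::finite) config) \<Rightarrow> real set \<Rightarrow> bool" where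
  "bounded_away_from_collision_antipodal \<kappa> q S \<longleftrightarrow>
    (\<exists>\<epsilon>>0. \<forall>t\<in>S. \<forall>c \<in> Delta_plus \<kappa> \<inter> Delta_minus \<kappa>. \<epsilon> \<le> dist (q t) c)"

text \<open>
  An analytic extension is an analytic function on a longer interval agreeing with the solution
  on \<open>{0..<T}\<close>; it is not required to avoid the singular set at or after time \<open>T\<close>. Hence being a
  singularity also rules out every extension as a solution of the equations of motion.
\<close>

definition is_singularity ::
  "(real \<Rightarrow> ('n::finite) config) \<Rightarrow> (real \<Rightarrow> 'n config) \<Rightarrow> real \<Rightarrow> bool" where
  "is_singularity q p T \<longleftrightarrow>
    \<not> (\<exists>T'>T. \<exists>Q P :: real \<Rightarrow> 'n config.
        real_analytic_on Q {0..<T'} \<and> real_analytic_on P {0..<T'} \<and>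
        (\<forall>t\<in>{0..<T}. Q t = q t \<and> P t = p t))"

end

theory Submission imports Defs begin

text \<open>
  Suppose that the solution extends analytically beyond \<open>T\<close>. Then positions and momenta converge
  as \<open>t \<rightarrow> T\<close>, and the limit configuration contains a collision: a set \<open>C\<close> of at least two bodies
  whose positions converge to one point \<open>a\<close>, while the limits \<open>b\<close> of the other bodies satisfy
  \<open>\<kappa> a \<odot> b \<noteq> 1\<close> (\<open>M2_eq_if_odot_eq_1\<close>). No pair is antipodal in the limit: for \<open>\<kappa> > 0\<close> the limit
  would be a collision-antipodal configuration, and for \<open>\<kappa> < 0\<close> all products \<open>\<kappa> q\<^sub>i \<odot> q\<^sub>j\<close> are
  at least \<open>1\<close> (\<open>hyperboloid_odot_ge_1\<close>).

  The contradiction comes from the total momentum of the cluster \<open>C\<close> in the direction \<open>a\<close>. In flat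
  space the mutual forces in \<open>C\<close> cancel; on a curved surface they do not. The forces which two
  bodies \<open>i\<close>, \<open>j\<close> exert on each other are \<open>A (q\<^sub>j - c q\<^sub>i)\<close> and \<open>A (q\<^sub>i - c q\<^sub>j)\<close> with
  \<open>c = \<kappa> q\<^sub>i \<odot> q\<^sub>j\<close>, so their sum is \<open>A (1 - c) (q\<^sub>i + q\<^sub>j)\<close>. With \<open>s = \<sigma> (1 - c\<^sup>2)\<close> the factor \<open>A\<close>
  is a positive multiple of \<open>s powr (- 3/2)\<close>, and \<open>\<sigma> (1 - c) = s / (1 + c)\<close>; hence
  \<open>\<sigma> A (1 - c)\<close> behaves like \<open>s powr (- 1/2)\<close> and tends to \<open>+\<infinity>\<close> at a collision
  (\<open>collision_attraction_at_top\<close>). The vectors \<open>\<kappa> q\<^sub>i\<close> with \<open>i\<close> in \<open>C\<close> have a product with \<open>a\<close> that tends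
  to \<open>1\<close>, so all pairs in \<open>C\<close> push \<open>\<sigma> \<kappa> (\<Sum>i\<in>C. p\<^sub>i \<odot> a)\<close> in the same direction and no cancellation
  is possible. The forces from outside \<open>C\<close> and the constraint forces converge, so the derivative of
  this quantity tends to \<open>+\<infinity>\<close> (\<open>cluster_momentum_rate_at_top\<close>). By the mean value theorem it is then
  not differentiable at \<open>T\<close> (\<open>not_differentiable_if_deriv_at_top\<close>), which contradicts analyticity of
  the extended momenta.
\<close>

section \<open>The bilinear form\<close>

lemma odot_commute: "odot \<kappa> a b = odot \<kappa> b a"
  by (simp add: odot_def mult.commute)

lemma linear_odot_left: "linear (\<lambda>v. odot \<kappa> v a)"
  by (rule linearI) (simp_all add: odot_def algebra_simps)

lemma tendsto_odot [tendsto_intros]: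
  assumes "(f \<longlongrightarrow> a) F" "(g \<longlongrightarrow> b) F"
  shows "((\<lambda>t. odot \<kappa> (f t) (g t)) \<longlongrightarrow> odot \<kappa> a b) F"
  unfolding odot_def by (intro tendsto_intros assms)

section \<open>Geometry of the surface\<close>

lemma M2_odot_self: "u \<in> M2 \<kappa> \<Longrightarrow> \<kappa> * odot \<kappa> u u = 1"
  by (simp add: M2_def)

text \<open>
  Lagrange's identity for the vectors \<open>(x, y, sqrt (- 1/\<kappa>))\<close>, whose squared length is the squared
  height \<open>z\<^sup>2\<close> of the point of the hyperboloid. It yields the reversed Cauchy-Schwarz inequality and
  its equality case.
\<close>

lemma hyperboloid_lagrange:
  assumes "\<kappa> < 0" "u \<in> M2 \<kappa>" "v \<in> M2 \<kappa>"
  shows "(u$3 * v$3)\<^sup>2 = (u$1 * v$1 + u$2 * v$2 - 1/\<kappa>)\<^sup>2 +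
    ((u$1 * v$2 - u$2 * v$1)\<^sup>2 + (- 1/\<kappa>) * ((u$1 - v$1)\<^sup>2 + (u$2 - v$2)\<^sup>2))"
proof -
  define d where "d = - 1/\<kappa>"
  have height: "(w$3)\<^sup>2 = (w$1)\<^sup>2 + (w$2)\<^sup>2 + d" if "w \<in> M2 \<kappa>" for w
  proof -
    have "\<kappa> * ((w$1)\<^sup>2 + (w$2)\<^sup>2 - (w$3)\<^sup>2) = 1"
      using that assms(1) by (simp add: M2_def odot_def power2_eq_square)
    then show ?thesis
      using assms(1) by (simp add: d_def field_simps)
  qed
  have "(u$3 * v$3)\<^sup>2 = ((u$1)\<^sup>2 + (u$2)\<^sup>2 + d) * ((v$1)\<^sup>2 + (v$2)\<^sup>2 + d)"
    by (simp add: power_mult_distrib height assms)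
  then show ?thesis
    unfolding d_def[symmetric] by (simp add: d_def power2_eq_square algebra_simps)
qed

text \<open>
  In particular there are no antipodal configurations for negative curvature. It matters here that
  only the upper sheet is taken: the product of the heights is positive.
\<close>

lemma hyperboloid_odot_ge_1:
  assumes "\<kappa> < 0" "u \<in> M2 \<kappa>" "v \<in> M2 \<kappa>"
  shows "\<kappa> * odot \<kappa> u v \<ge> 1"
proof -
  have "0 < u$3 * v$3"
    using assms by (simp add: M2_def)
  moreover have "(- 1/\<kappa>) * ((u$1 - v$1)\<^sup>2 + (u$2 - v$2)\<^sup>2) \<ge> 0"
    using assms(1) by (intro mult_nonneg_nonneg) (auto simp: field_simps)
  then have "(u$1 * v$1 + u$2 * v$2 - 1/\<kappa>)\<^sup>2 \<le> (u$3 * v$3)\<^sup>2"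
    unfolding hyperboloid_lagrange[OF assms] by (smt (verit) zero_le_power2)
  ultimately have "u$1 * v$1 + u$2 * v$2 - 1/\<kappa> \<le> u$3 * v$3"
    by (meson less_imp_le power2_le_imp_le)
  then show ?thesis
    using assms(1) by (simp add: odot_def field_simps)
qed

text \<open>
  The equality case of the Cauchy-Schwarz inequality, or of its reversed form for negative
  curvature. It separates the bodies that take part in a collision from all others.
\<close>

lemma M2_eq_if_odot_eq_1:
  assumes "\<kappa> \<noteq> 0" "u \<in> M2 \<kappa>" "v \<in> M2 \<kappa>" "\<kappa> * odot \<kappa> u v = 1"
  shows "u = v"
proof (cases "\<kappa> > 0")
  case True
  have "\<kappa> * ((u$1 - v$1)\<^sup>2 + (u$2 - v$2)\<^sup>2 + (u$3 - v$3)\<^sup>2)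
      = \<kappa> * odot \<kappa> u u + \<kappa> * odot \<kappa> v v - 2 * (\<kappa> * odot \<kappa> u v)"
    using True by (simp add: odot_def power2_eq_square algebra_simps)
  also have "\<dots> = 0"
    using assms by (simp add: M2_odot_self)
  finally have "(u$1 - v$1)\<^sup>2 + (u$2 - v$2)\<^sup>2 + (u$3 - v$3)\<^sup>2 = 0"
    using True by simp
  then have "u$1 = v$1 \<and> u$2 = v$2 \<and> u$3 = v$3"
    by (smt (verit) zero_le_power2 zero_eq_power2)
  then show ?thesis
    by (simp add: vec_eq_iff forall_3)
next
  case False
  then have neg: "\<kappa> < 0"
    using assms(1) by simp
  have "u$1 * v$1 + u$2 * v$2 - 1/\<kappa> = u$3 * v$3"
    using neg assms(4) by (simp add: odot_def field_simps)
  then have "(u$1 * v$2 - u$2 * v$1)\<^sup>2 + (- 1/\<kappa>) * ((u$1 - v$1)\<^sup>2 + (u$2 - v$2)\<^sup>2) = 0"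
    using hyperboloid_lagrange[OF neg assms(2,3)] by simp
  moreover have "(- 1/\<kappa>) * ((u$1 - v$1)\<^sup>2 + (u$2 - v$2)\<^sup>2) \<ge> 0"
    using neg by (intro mult_nonneg_nonneg) (auto simp: field_simps)
  ultimately have "(- 1/\<kappa>) * ((u$1 - v$1)\<^sup>2 + (u$2 - v$2)\<^sup>2) = 0"
    by (smt (verit) zero_le_power2)
  then have 12: "u$1 = v$1 \<and> u$2 = v$2"
    using neg by (simp add: sum_power2_eq_zero_iff)
  have "(w$3)\<^sup>2 = (w$1)\<^sup>2 + (w$2)\<^sup>2 - 1/\<kappa>" if "w \<in> M2 \<kappa>" for w
    using that neg by (simp add: M2_def odot_def power2_eq_square field_simps)
  then have "(u$3)\<^sup>2 = (v$3)\<^sup>2"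
    using 12 assms by simp
  moreover have "u$3 > 0" "v$3 > 0"
    using neg assms by (auto simp: M2_def)
  ultimately have "u$3 = v$3"
    by (simp add: power2_eq_iff_nonneg)
  with 12 show ?thesis
    by (simp add: vec_eq_iff forall_3)
qed

text \<open>
  Away from collisions and antipodal pairs the base of the power in the denominator of
  \<^const>\<open>grad_U\<close> is positive.
\<close>

lemma M2_discriminant_pos:
  assumes "\<kappa> \<noteq> 0" "u \<in> M2 \<kappa>" "v \<in> M2 \<kappa>"
    and "\<kappa> * odot \<kappa> u v \<noteq> 1" "\<kappa> * odot \<kappa> u v \<noteq> -1"
  shows "sgn \<kappa> - sgn \<kappa> * (\<kappa> * odot \<kappa> u v)\<^sup>2 > 0"
proof (cases "\<kappa> > 0")
  case True
  define n where "n w = (w$1)\<^sup>2 + (w$2)\<^sup>2 + (w$3)\<^sup>2" for w :: "real^3"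
  have "\<kappa> * n w = 1" if "w \<in> M2 \<kappa>" for w
    using that True by (simp add: M2_def odot_def n_def power2_eq_square)
  then have "1 - (\<kappa> * odot \<kappa> u v)\<^sup>2 = (\<kappa> * n u) * (\<kappa> * n v) - (\<kappa> * odot \<kappa> u v)\<^sup>2"
    using assms by simp
  also have "\<dots> = \<kappa>\<^sup>2 * ((u$1 * v$2 - u$2 * v$1)\<^sup>2 + (u$1 * v$3 - u$3 * v$1)\<^sup>2
      + (u$2 * v$3 - u$3 * v$2)\<^sup>2)"
    using True by (simp add: n_def odot_def power2_eq_square algebra_simps)
  also have "\<dots> \<ge> 0"
    by simp
  finally have "1 - (\<kappa> * odot \<kappa> u v)\<^sup>2 \<ge> 0" .
  moreover have "(\<kappa> * odot \<kappa> u v)\<^sup>2 \<noteq> 1"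
    using assms by (simp add: power2_eq_1_iff)
  ultimately show ?thesis
    using True by simp
next
  case False
  then have "\<kappa> < 0" "\<kappa> * odot \<kappa> u v > 1"
    using assms hyperboloid_odot_ge_1[of \<kappa> u v] by auto
  then show ?thesis
    using one_less_power[of "\<kappa> * odot \<kappa> u v" 2] by simp
qed

text \<open>
  The condition \<open>z > 0\<close> may be relaxed to the closed condition \<open>z \<ge> 0\<close>, because the hyperboloid
  does not meet the plane \<open>z = 0\<close>.
\<close>

lemma closed_M2: "closed (M2 \<kappa>)"
proof -
  have "M2 \<kappa> = {v. \<kappa> * odot \<kappa> v v = 1} \<inter> {v. \<kappa> < 0 \<longrightarrow> v$3 \<ge> 0}"
  proof (intro set_eqI iffI)
    fix v
    assume v: "v \<in> {v. \<kappa> * odot \<kappa> v v = 1} \<inter> {v. \<kappa> < 0 \<longrightarrow> v$3 \<ge> 0}"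
    have "v$3 \<noteq> 0" if "\<kappa> < 0"
    proof
      assume "v$3 = 0"
      then have "\<kappa> * ((v$1)\<^sup>2 + (v$2)\<^sup>2) = 1"
        using v by (simp add: odot_def power2_eq_square)
      moreover have "\<kappa> * ((v$1)\<^sup>2 + (v$2)\<^sup>2) \<le> 0"
        using that by (intro mult_nonpos_nonneg) auto
      ultimately show False by simp
    qed
    with v show "v \<in> M2 \<kappa>"
      by (auto simp: M2_def order.strict_iff_order)
  qed (auto simp: M2_def)
  moreover have "closed {v. \<kappa> * odot \<kappa> v v = 1}"
    unfolding odot_def by (intro closed_Collect_eq continuous_intros)
  moreover have "closed {v :: real^3. \<kappa> < 0 \<longrightarrow> v$3 \<ge> 0}"
    by (cases "\<kappa> < 0") (auto intro!: closed_Collect_le continuous_intros)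
  ultimately show ?thesis
    by (simp add: closed_Int)
qed

section \<open>Limits and derivatives\<close>

lemma tendsto_Min_image:
  fixes f :: "'i \<Rightarrow> 'a \<Rightarrow> real"
  assumes "finite I" "I \<noteq> {}" "\<And>i. i \<in> I \<Longrightarrow> (f i \<longlongrightarrow> l i) F"
  shows "((\<lambda>t. Min ((\<lambda>i. f i t) ` I)) \<longlongrightarrow> Min (l ` I)) F"
  using assms by (induction rule: finite_ne_induct) (auto intro!: tendsto_min)

lemma filterlim_sum_at_top:
  fixes f :: "'i \<Rightarrow> 'a \<Rightarrow> real"
  assumes "finite I" "I \<noteq> {}" "\<And>i. i \<in> I \<Longrightarrow> filterlim (f i) at_top F"
  shows "filterlim (\<lambda>t. \<Sum>i\<in>I. f i t) at_top F"
  using assms by (induction rule: finite_ne_induct) (auto intro!: filterlim_at_top_add_at_top)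

text \<open>
  A bounded linear functional turns the vector-valued expansion into a scalar power series, which
  may be differentiated at its centre. The centre has to be an interior point of the interval, for
  only then does the series represent the function on both sides.
\<close>

lemma real_analytic_on_differentiable:
  assumes f: "real_analytic_on f {0..<b}" and t: "0 < t" "t < b" and L: "bounded_linear L"
  shows "\<exists>D. ((\<lambda>s. L (f s)) has_real_derivative D) (at t)"
proof -
  obtain r0 a where r0: "r0 > 0"
    and a: "\<And>s. s \<in> {0..<b} \<Longrightarrow> \<bar>s - t\<bar> < r0 \<Longrightarrow> (\<lambda>k. (s - t)^k *\<^sub>R a k) sums f s"
    using f t unfolding real_analytic_on_def by (meson atLeastLessThan_iff less_imp_le)
  define r where "r = Min {r0, t, b - t}"
  have r: "r > 0" "r \<le> r0" "r \<le> t" "r \<le> b - t"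
    using r0 t by (auto simp: r_def)
  have sums: "(\<lambda>k. L (a k) * x^k) sums L (f (t + x))" if "\<bar>x\<bar> < r" for x
  proof -
    have "t + x \<in> {0..<b}" "\<bar>(t + x) - t\<bar> < r0"
      using that r by auto
    from bounded_linear.sums[OF L a[OF this]] show ?thesis
      by (simp add: bounded_linear.linear[OF L, THEN linear_scale] mult.commute)
  qed
  have "((\<lambda>x. \<Sum>k. L (a k) * x^k) has_real_derivative (\<Sum>k. diffs (\<lambda>k. L (a k)) k * 0^k)) (at 0)"
    using sums_summable[OF sums[of "r/2"]] r by (intro termdiffs_strong) auto
  moreover have "\<forall>\<^sub>F x in nhds 0. (\<Sum>k. L (a k) * x^k) = L (f (t + x))"
    using eventually_nhds_in_open[of "{-r<..<r}" 0] r
    by (auto elim!: eventually_mono intro!: sums_unique[symmetric] sums)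
  ultimately have "((\<lambda>x. L (f (t + x))) has_real_derivative
      (\<Sum>k. diffs (\<lambda>k. L (a k)) k * 0^k)) (at 0)"
    by (subst (asm) DERIV_cong_ev[OF refl _ refl]) auto
  then show ?thesis
    using DERIV_at_within_shift[of "\<lambda>s. L (f s)" _ t 0 UNIV]
    by (metis surj_plus add.right_neutral)
qed

lemma real_analytic_on_tendsto:
  fixes f :: "real \<Rightarrow> 'a::euclidean_space"
  assumes "real_analytic_on f {0..<b}" "0 < t" "t < b"
  shows "(f \<longlongrightarrow> f t) (at t)"
proof -
  have "((\<lambda>s. f s \<bullet> e) \<longlongrightarrow> f t \<bullet> e) (at t)" for e
    using real_analytic_on_differentiable[OF assms bounded_linear_inner_left[of e]]
      DERIV_isCont isCont_def by blast
  then show ?thesis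
    by (subst tendsto_componentwise_iff) simp
qed

text \<open>
  By the mean value theorem, difference quotients from the left are values of the derivative, and
  hence eventually exceed the alleged derivative by at least \<open>1\<close>.
\<close>

lemma not_differentiable_if_deriv_at_top:
  fixes f f' :: "real \<Rightarrow> real"
  assumes "a < b" and D: "(f has_real_derivative D) (at b)"
    and deriv: "\<And>t. a < t \<Longrightarrow> t < b \<Longrightarrow> (f has_real_derivative f' t) (at t)"
    and top: "filterlim f' at_top (at_left b)"
  shows False
proof -
  have "\<forall>\<^sub>F t in at_left b. f' t \<ge> D + 1"
    using top by (simp add: filterlim_at_top)
  then obtain a' where a': "a' < b" and big: "\<And>t. a' < t \<Longrightarrow> t < b \<Longrightarrow> f' t \<ge> D + 1"
    unfolding eventually_at_left_field by blast
  have "\<forall>\<^sub>F t in at_left b. (f t - f b) / (t - b) \<ge> D + 1"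
    using eventually_at_left_real[of "max a a'" b] a' assms(1)
  proof (auto elim!: eventually_mono)
    fix t assume t: "a < t" "a' < t" "t < b"
    have "\<exists>l z. t < z \<and> z < b \<and> (f has_real_derivative l) (at z) \<and> f b - f t = (b - t) * l"
    proof (rule MVT)
      show "continuous_on {t..b} f"
        unfolding continuous_on_eq_continuous_within
        using t DERIV_isCont[OF D] DERIV_isCont[OF deriv]
        by (metis atLeastAtMost_iff continuous_at_imp_continuous_at_within
            order.strict_iff_order order.strict_trans2)
      show "f differentiable (at x)" if "t < x" "x < b" for x
        using deriv[of x] that t real_differentiable_def by fastforce
    qed (use t in simp)
    then obtain l z where z: "t < z" "z < b" "(f has_real_derivative l) (at z)"
        "f b - f t = (b - t) * l"
      by blast
    then have "l = f' z"
      using deriv[of z] t DERIV_unique by fastforce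
    then have "l \<ge> D + 1"
      using big z t by simp
    moreover have "(f t - f b) / (t - b) = l"
      using z(4) t by (simp add: field_simps)
    ultimately show "D + 1 \<le> (f t - f b) / (t - b)"
      by simp
  qed
  moreover have "((\<lambda>t. (f t - f b) / (t - b)) \<longlongrightarrow> D) (at_left b)"
    using D unfolding has_field_derivative_iff by (rule tendsto_within_subset) simp
  ultimately have "D + 1 \<le> D"
    by (intro tendsto_lowerbound) auto
  then show False by simp
qed

section \<open>The force near a cluster\<close>

text \<open>
  The scalar factor of the mutual forces in \<^const>\<open>grad_U\<close> after the simplification
  \<open>\<kappa> q\<^sub>i \<odot> q\<^sub>i = 1\<close>, which holds on the surface and makes the factor symmetric in the two bodies.
\<close>

definition attraction :: "real \<Rightarrow> ('n::finite \<Rightarrow> real) \<Rightarrow> 'n config \<Rightarrow> 'n \<Rightarrow> 'n \<Rightarrow> real" where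
  "attraction \<kappa> m q i j = m i * m j * (sgn \<kappa> * \<kappa>) powr (3/2)
     / (sgn \<kappa> - sgn \<kappa> * (\<kappa> * odot \<kappa> (q$i) (q$j))\<^sup>2) powr (3/2)"

lemma attraction_commute: "attraction \<kappa> m q i j = attraction \<kappa> m q j i"
  by (simp add: attraction_def odot_commute mult.commute)

lemma odot_grad_U_on_M2:
  assumes "\<And>i. q$i \<in> M2 \<kappa>"
  shows "odot \<kappa> (grad_U \<kappa> m q i) a =
    (\<Sum>j\<in>UNIV - {i}. attraction \<kappa> m q i j *
       (odot \<kappa> (q$j) a - \<kappa> * odot \<kappa> (q$i) (q$j) * odot \<kappa> (q$i) a))"
proof -
  have self: "\<kappa> * odot \<kappa> (q$j) (q$j) = 1" for j
    using assms by (rule M2_odot_self)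
  interpret linear "\<lambda>v. odot \<kappa> v a"
    by (rule linear_odot_left)
  show ?thesis
    unfolding grad_U_def self attraction_def by (simp add: sum scale diff)
qed

text \<open>
  Adding the two mutual forces of every pair: by the symmetry of \<open>A\<close> the term \<open>A i j * h j\<close> may be
  booked on body \<open>j\<close> instead of body \<open>i\<close>.
\<close>

lemma cluster_force_symmetrize:
  fixes A c :: "'n \<Rightarrow> 'n \<Rightarrow> real"
  assumes "finite C" "\<And>i j. A i j = A j i"
  shows "(\<Sum>i\<in>C. \<Sum>j\<in>C - {i}. A i j * (h j - c i j * h i))
       = (\<Sum>i\<in>C. \<Sum>j\<in>C - {i}. A i j * (1 - c i j) * h i)"
proof -
  have "(\<Sum>i\<in>C. \<Sum>j\<in>C - {i}. A i j * h j) = (\<Sum>j\<in>C. \<Sum>i\<in>{i\<in>C. j \<in> C - {i}}. A i j * h j)"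
    using sum.swap_restrict[OF assms(1) assms(1), of "\<lambda>i j. A i j * h j" "\<lambda>i j. j \<noteq> i"]
    by (auto simp: set_diff_eq intro!: sum.cong)
  also have "\<dots> = (\<Sum>i\<in>C. \<Sum>j\<in>C - {i}. A i j * h i)"
    by (intro sum.cong) (auto simp: assms(2))
  finally show ?thesis
    by (simp add: algebra_simps sum_subtractf)
qed

lemma cluster_force_decomposition:
  fixes q :: "('n::finite) config"
  assumes q: "\<And>i. q$i \<in> M2 \<kappa>"
  shows "(\<Sum>i\<in>C. \<kappa> * odot \<kappa> (grad_U \<kappa> m q i) a) =
    (\<Sum>i\<in>C. \<Sum>j\<in>C - {i}. attraction \<kappa> m q i j * (1 - \<kappa> * odot \<kappa> (q$i) (q$j)) * (\<kappa> * odot \<kappa> (q$i) a))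
    + (\<Sum>i\<in>C. \<Sum>j\<in>-C. attraction \<kappa> m q i j *
        (\<kappa> * odot \<kappa> (q$j) a - \<kappa> * odot \<kappa> (q$i) (q$j) * (\<kappa> * odot \<kappa> (q$i) a)))"
proof -
  define f where "f i j = attraction \<kappa> m q i j *
        (\<kappa> * odot \<kappa> (q$j) a - \<kappa> * odot \<kappa> (q$i) (q$j) * (\<kappa> * odot \<kappa> (q$i) a))" for i j
  have "\<kappa> * odot \<kappa> (grad_U \<kappa> m q i) a = (\<Sum>j\<in>C - {i}. f i j) + (\<Sum>j\<in>-C. f i j)"
    if "i \<in> C" for i
  proof -
    have "\<kappa> * odot \<kappa> (grad_U \<kappa> m q i) a = (\<Sum>j\<in>UNIV - {i}. f i j)"
      by (subst odot_grad_U_on_M2)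
        (auto simp: q f_def sum_distrib_left algebra_simps intro!: sum.cong)
    also have "UNIV - {i} = (C - {i}) \<union> (- C)"
      using that by auto
    also have "sum (f i) \<dots> = (\<Sum>j\<in>C - {i}. f i j) + (\<Sum>j\<in>-C. f i j)"
      by (rule sum.union_disjoint) auto
    finally show ?thesis .
  qed
  then have "(\<Sum>i\<in>C. \<kappa> * odot \<kappa> (grad_U \<kappa> m q i) a)
      = (\<Sum>i\<in>C. \<Sum>j\<in>C - {i}. f i j) + (\<Sum>i\<in>C. \<Sum>j\<in>-C. f i j)"
    by (simp add: sum.distrib)
  then show ?thesis
    unfolding f_def by (subst (asm) cluster_force_symmetrize) (simp_all add: attraction_commute)
qed

text \<open>
  The decisive divergence. Applied to \<open>\<sigma> = sgn \<kappa>\<close> and \<open>c = \<kappa> q\<^sub>i \<odot> q\<^sub>j\<close>, it says that the sum of the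
  two mutual forces of a colliding pair is unbounded, with a sign determined by the curvature.
\<close>

lemma collision_attraction_at_top:
  fixes c :: "'a \<Rightarrow> real"
  assumes c: "(c \<longlongrightarrow> 1) F" and K: "K > 0"
    and pos: "\<forall>\<^sub>F t in F. \<sigma> - \<sigma> * (c t)\<^sup>2 > 0"
  shows "filterlim (\<lambda>t. \<sigma> * (K / (\<sigma> - \<sigma> * (c t)\<^sup>2) powr (3/2) * (1 - c t))) at_top F"
proof -
  define s where "s t = \<sigma> - \<sigma> * (c t)\<^sup>2" for t
  have "(s \<longlongrightarrow> \<sigma> - \<sigma> * 1\<^sup>2) F"
    unfolding s_def by (intro tendsto_intros c)
  moreover have "\<forall>\<^sub>F t in F. s t > 0"
    using pos by (simp add: s_def)
  then have "\<forall>\<^sub>F t in F. s t \<in> {0<..} \<and> s t \<noteq> 0"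
    by eventually_elim simp
  ultimately have "filterlim s (at_right 0) F"
    by (simp add: filterlim_at)
  moreover have "filterlim (\<lambda>x :: real. x powr (- (1/2))) at_top (at_right 0)"
  proof -
    have "filterlim (\<lambda>x. sqrt x) (at_right 0) (at_right 0)"
      unfolding filterlim_at using tendsto_real_sqrt[OF tendsto_ident_at, of 0 "{0<..}"]
      by (auto intro: eventually_mono[OF eventually_at_right_less[of 0]])
    then have "filterlim (\<lambda>x. inverse (sqrt x)) at_top (at_right 0)"
      by (rule filterlim_compose[OF filterlim_inverse_at_top_right])
    moreover have "\<forall>\<^sub>F x :: real in at_right 0. inverse (sqrt x) = x powr (- (1/2))"
      using eventually_at_right_less[of 0]
      by eventually_elim (simp add: powr_minus powr_half_sqrt)
    ultimately show ?thesis
      by (rule filterlim_cong[OF refl refl, THEN iffD1, rotated])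
  qed
  ultimately have "filterlim (\<lambda>t. s t powr (- (1/2))) at_top F"
    by (rule filterlim_compose[rotated])
  moreover have "((\<lambda>t. K / (1 + c t)) \<longlongrightarrow> K / (1 + 1)) F"
    by (intro tendsto_intros c) simp
  ultimately have "filterlim (\<lambda>t. K / (1 + c t) * s t powr (- (1/2))) at_top F"
    using K by (intro filterlim_tendsto_pos_mult_at_top[where c = "K / 2"]) auto
  moreover have "\<forall>\<^sub>F t in F. c t > 0"
    using c by (rule order_tendstoD) simp
  then have "\<forall>\<^sub>F t in F. K / (1 + c t) * s t powr (- (1/2))
      = \<sigma> * (K / (\<sigma> - \<sigma> * (c t)\<^sup>2) powr (3/2) * (1 - c t))"
    using pos
  proof eventually_elim
    case (elim t)
    \<comment> \<open>One factor \<open>s\<close> of the numerator cancels against the power \<open>3/2\<close>.\<close>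
    have "s t powr (- (1/2)) = s t / s t powr (3/2)"
      using powr_diff[of "s t" 1 "3/2"] elim by (simp add: s_def)
    moreover have "s t = \<sigma> * (1 - c t) * (1 + c t)"
      by (simp add: s_def power2_eq_square algebra_simps)
    ultimately have "s t powr (- (1/2)) = \<sigma> * (1 - c t) * (1 + c t) / s t powr (3/2)"
      by simp
    with elim show ?case
      by (simp add: s_def)
  qed
  ultimately show ?thesis
    by (rule filterlim_cong[OF refl refl, THEN iffD1, rotated])
qed

section \<open>Momentum of a collapsing cluster\<close>

abbreviation momentum_rate ::
  "real \<Rightarrow> ('n::finite \<Rightarrow> real) \<Rightarrow> 'n config \<Rightarrow> 'n config \<Rightarrow> 'n \<Rightarrow> real^3" where
  "momentum_rate \<kappa> m q p i \<equiv>
     grad_U \<kappa> m q i - (inverse (m i) * \<kappa> * odot \<kappa> (p $ i) (p $ i)) *\<^sub>R q $ i"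

text \<open>
  Every ordered pair inside the cluster contributes a diverging term as in
  \<open>collision_attraction_at_top\<close>, with a weight \<open>\<kappa> q\<^sub>i \<odot> a\<close> that tends to \<open>\<kappa> a \<odot> a = 1\<close>. Everything else converges: pairs with one body outside the
  cluster stay away from the singularities of the force, and the constraint forces are continuous
  in positions and momenta. The factor \<open>sgn \<kappa>\<close> makes the diverging terms positive for both signs of
  the curvature.
\<close>

lemma cluster_momentum_rate_at_top:
  fixes q p :: "'a \<Rightarrow> ('n::finite) config" and Q P :: "'n config" and a :: "real^3"
  defines "C \<equiv> {j. Q $ j = a}"
  assumes \<kappa>: "\<kappa> \<noteq> 0" and m: "\<And>i. m i > 0"
    and q_lim: "(q \<longlongrightarrow> Q) F" and p_lim: "(p \<longlongrightarrow> P) F"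
    and regular: "\<forall>\<^sub>F t in F. (\<forall>i. q t $ i \<in> M2 \<kappa>) \<and> q t \<notin> Delta_plus \<kappa> \<union> Delta_minus \<kappa>"
    and QM: "\<And>i. Q $ i \<in> M2 \<kappa>"
    and not_antipodal: "\<And>i j. i \<noteq> j \<Longrightarrow> \<kappa> * odot \<kappa> (Q $ i) (Q $ j) \<noteq> -1"
    and C: "i0 \<in> C" "j0 \<in> C" "i0 \<noteq> j0"
  shows "filterlim (\<lambda>t. \<Sum>i\<in>C. sgn \<kappa> * \<kappa> * odot \<kappa> (momentum_rate \<kappa> m (q t) (p t) i) a) at_top F"
proof -
  define \<sigma> where "\<sigma> = sgn \<kappa>"
  define A where "A i j t = attraction \<kappa> m (q t) i j" for i j t
  define c where "c i j t = \<kappa> * odot \<kappa> (q t $ i) (q t $ j)" for i j t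
  define c' where "c' i j = \<kappa> * odot \<kappa> (Q $ i) (Q $ j)" for i j
  define h where "h i t = \<kappa> * odot \<kappa> (q t $ i) a" for i t
  define h' where "h' i = \<kappa> * odot \<kappa> (Q $ i) a" for i
  have c_lim: "(c i j \<longlongrightarrow> c' i j) F" for i j
    unfolding c_def c'_def by (intro tendsto_intros q_lim)
  have h_lim: "(h i \<longlongrightarrow> h' i) F" for i
    unfolding h_def h'_def by (intro tendsto_intros q_lim)
  have h'_C: "h' i = 1" if "i \<in> C" for i
    using that QM[of i] by (simp add: h'_def C_def M2_odot_self)
  have c'_C: "c' i j = 1" if "i \<in> C" "j \<in> C" for i j
    using that QM[of i] by (simp add: c'_def C_def M2_odot_self)
  have c'_outside: "c' i j \<noteq> 1" if "i \<in> C" "j \<notin> C" for i j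
    using that M2_eq_if_odot_eq_1[OF \<kappa> QM[of i] QM[of j]] by (auto simp: C_def c'_def)

  define within_C where
    "within_C t = (\<Sum>i\<in>C. \<Sum>j\<in>C - {i}. \<sigma> * (A i j t * (1 - c i j t)) * h i t)" for t
  define rest where
    "rest t = \<sigma> * (\<Sum>i\<in>C. \<Sum>j\<in>-C. A i j t * (h j t - c i j t * h i t))
        - \<sigma> * (\<Sum>i\<in>C. inverse (m i) * \<kappa> * odot \<kappa> (p t $ i) (p t $ i) * h i t)" for t

  have "filterlim within_C at_top F"
    unfolding within_C_def
  proof (intro filterlim_sum_at_top)
    show "C \<noteq> {}" "\<And>i. C - {i} \<noteq> {}"
      using C by auto
    fix i j assume i: "i \<in> C" and j: "j \<in> C - {i}"
    have "\<forall>\<^sub>F t in F. \<sigma> - \<sigma> * (c i j t)\<^sup>2 > 0"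
      using regular
    proof eventually_elim
      case (elim t)
      then have "q t \<notin> Delta_plus \<kappa>" "q t \<notin> Delta_minus \<kappa>" and M: "\<forall>i. q t $ i \<in> M2 \<kappa>"
        by auto
      moreover have "i \<noteq> j"
        using j by auto
      ultimately have "c i j t \<noteq> 1" "c i j t \<noteq> -1"
        unfolding Delta_plus_def Delta_minus_def c_def mem_Collect_eq by metis+
      then show ?case
        unfolding \<sigma>_def c_def using M by (intro M2_discriminant_pos \<kappa>) auto
    qed
    moreover have "(c i j \<longlongrightarrow> 1) F"
      using c_lim[of i j] c'_C[of i j] i j by simp
    moreover have "m i * m j * (sgn \<kappa> * \<kappa>) powr (3/2) > 0"
      using \<kappa> m by (simp add: sgn_if)
    ultimately have pair: "filterlim (\<lambda>t. \<sigma> * (A i j t * (1 - c i j t))) at_top F"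
      unfolding A_def attraction_def c_def \<sigma>_def by (rule collision_attraction_at_top[rotated 2])
    have "(h i \<longlongrightarrow> 1) F"
      using h_lim[of i] h'_C[OF i] by simp
    from filterlim_tendsto_pos_mult_at_top[OF this zero_less_one pair]
    show "filterlim (\<lambda>t. \<sigma> * (A i j t * (1 - c i j t)) * h i t) at_top F"
      by (simp add: mult.commute)
  qed simp_all

  moreover have A_lim: "(A i j \<longlongrightarrow> attraction \<kappa> m Q i j) F" if "i \<in> C" "j \<in> - C" for i j
  proof -
    have "sgn \<kappa> - sgn \<kappa> * (\<kappa> * odot \<kappa> (Q $ i) (Q $ j))\<^sup>2 > 0"
      using that c'_outside[of i j] not_antipodal[of i j]
      by (intro M2_discriminant_pos \<kappa> QM) (auto simp: c'_def)
    then show ?thesis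
      unfolding A_def attraction_def by (intro tendsto_intros q_lim) auto
  qed
  have "(rest \<longlongrightarrow> \<sigma> * (\<Sum>i\<in>C. \<Sum>j\<in>-C. attraction \<kappa> m Q i j * (h' j - c' i j * h' i))
        - \<sigma> * (\<Sum>i\<in>C. inverse (m i) * \<kappa> * odot \<kappa> (P $ i) (P $ i) * h' i)) F"
    unfolding rest_def by (intro tendsto_intros A_lim h_lim c_lim p_lim)
  ultimately have "filterlim (\<lambda>t. rest t + within_C t) at_top F"
    by (intro filterlim_tendsto_add_at_top)

  moreover have "\<forall>\<^sub>F t in F. rest t + within_C t
      = (\<Sum>i\<in>C. sgn \<kappa> * \<kappa> * odot \<kappa> (momentum_rate \<kappa> m (q t) (p t) i) a)"
    using regular
  proof eventually_elim
    case (elim t)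
    interpret odot_a: linear "\<lambda>v. odot \<kappa> v a"
      by (rule linear_odot_left)
    have "(\<Sum>i\<in>C. sgn \<kappa> * \<kappa> * odot \<kappa> (momentum_rate \<kappa> m (q t) (p t) i) a)
        = \<sigma> * (\<Sum>i\<in>C. \<kappa> * odot \<kappa> (grad_U \<kappa> m (q t) i) a)
          - \<sigma> * (\<Sum>i\<in>C. inverse (m i) * \<kappa> * odot \<kappa> (p t $ i) (p t $ i) * h i t)"
      by (simp add: \<sigma>_def h_def odot_a.diff odot_a.scale sum_distrib_left sum_subtractf[symmetric]
          algebra_simps)
    also have "(\<Sum>i\<in>C. \<kappa> * odot \<kappa> (grad_U \<kappa> m (q t) i) a)
        = (\<Sum>i\<in>C. \<Sum>j\<in>C - {i}. A i j t * (1 - c i j t) * h i t)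
          + (\<Sum>i\<in>C. \<Sum>j\<in>-C. A i j t * (h j t - c i j t * h i t))"
      unfolding A_def c_def h_def using elim by (intro cluster_force_decomposition) simp
    also have "\<sigma> * \<dots> = within_C t + \<sigma> * (\<Sum>i\<in>C. \<Sum>j\<in>-C. A i j t * (h j t - c i j t * h i t))"
      by (simp add: within_C_def distrib_left sum_distrib_left mult.assoc)
    finally show ?case
      by (simp add: rest_def)
  qed
  ultimately show ?thesis
    by (rule filterlim_cong[OF refl refl, THEN iffD1, rotated])
qed

section \<open>Collisions are singularities\<close>

text \<open>
  The pair that realises the minimum may change with time; but as there are finitely many pairs,
  the minimum is continuous and is attained by a single pair in the limit.
\<close>

lemma collision_pair_in_limit:
  fixes Q :: "('n::finite) config"
  assumes "CARD('n) \<ge> 2" "F \<noteq> bot" and q_lim: "(q \<longlongrightarrow> Q) F"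
    and min: "((\<lambda>t. Min {\<bar>\<kappa> * odot \<kappa> (q t $ i) (q t $ j) - 1\<bar> | i j. i \<noteq> j}) \<longlongrightarrow> 0) F"
  obtains i j where "i \<noteq> j" "\<kappa> * odot \<kappa> (Q $ i) (Q $ j) = 1"
proof -
  define I where "I = {x :: 'n \<times> 'n. fst x \<noteq> snd x}"
  define d where "d v x = \<bar>\<kappa> * odot \<kappa> (v $ fst x) (v $ snd x) - 1\<bar>" for v :: "'n config" and x
  obtain i j :: 'n where "i \<noteq> j"
    using assms(1) ex_card[of 2 "UNIV :: 'n set"] by (auto simp: card_2_iff)
  then have I: "finite I" "I \<noteq> {}"
    by (auto simp: I_def)
  have "((\<lambda>t. Min ((\<lambda>x. d (q t) x) ` I)) \<longlongrightarrow> Min (d Q ` I)) F"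
    unfolding d_def by (intro tendsto_Min_image I tendsto_intros q_lim)
  moreover have "{\<bar>\<kappa> * odot \<kappa> (v $ i) (v $ j) - 1\<bar> | i j. i \<noteq> j} = d v ` I" for v :: "'n config"
    unfolding I_def d_def image_def by auto
  ultimately have "Min (d Q ` I) = 0"
    using min tendsto_unique[OF assms(2)] by simp
  then obtain x where "x \<in> I" "d Q x = 0"
    using Min_in[of "d Q ` I"] I by auto
  then show ?thesis
    using that[of "fst x" "snd x"] by (simp add: I_def d_def)
qed

lemma limit_not_collision_antipodal:
  assumes "bounded_away_from_collision_antipodal \<kappa> q S"
    and q_lim: "(q \<longlongrightarrow> Q) F" "F \<noteq> bot" and S: "\<forall>\<^sub>F t in F. t \<in> S"
  shows "Q \<notin> Delta_plus \<kappa> \<inter> Delta_minus \<kappa>"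
proof
  assume Q: "Q \<in> Delta_plus \<kappa> \<inter> Delta_minus \<kappa>"
  obtain \<epsilon> where "\<epsilon> > 0"
    and \<epsilon>: "\<And>t x. t \<in> S \<Longrightarrow> x \<in> Delta_plus \<kappa> \<inter> Delta_minus \<kappa> \<Longrightarrow> \<epsilon> \<le> dist (q t) x"
    using assms(1) unfolding bounded_away_from_collision_antipodal_def by blast
  have "\<forall>\<^sub>F t in F. t \<in> S \<and> dist (q t) Q < \<epsilon>"
    using S tendstoD[OF q_lim(1) \<open>\<epsilon> > 0\<close>] by (rule eventually_conj)
  then obtain t where "t \<in> S" "dist (q t) Q < \<epsilon>"
    using eventually_happens'[OF q_lim(2)] by blast
  with \<epsilon>[of t Q] Q show False
    by simp
qed

theorem theorem2:
  fixes \<kappa> T :: real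
    and m :: "'n::finite \<Rightarrow> real"
    and q p :: "real \<Rightarrow> (real^3)^'n"
  assumes "\<kappa> \<noteq> 0"
    and "CARD('n) \<ge> 2"
    and "\<And>i. m i > 0"
    and "0 < T"
    and "analytic_solution_on \<kappa> m q p {0..<T}"
    and "\<kappa> > 0 \<Longrightarrow> bounded_away_from_collision_antipodal \<kappa> q {0..<T}"
    and "((\<lambda>t. Min {\<bar>\<kappa> * odot \<kappa> (q t $ i) (q t $ j) - 1\<bar> | i j. i \<noteq> j}) \<longlongrightarrow> 0) (at_left T)"
  shows "is_singularity q p T"
proof (unfold is_singularity_def, intro notI, elim exE conjE)
  fix T' :: real and Q P :: "real \<Rightarrow> (real^3)^'n"
  assume "T < T'" and Q: "real_analytic_on Q {0..<T'}" and P: "real_analytic_on P {0..<T'}"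
    and ext: "\<forall>t\<in>{0..<T}. Q t = q t \<and> P t = p t"
  have sol: "solution_on \<kappa> m q p {0..<T}"
    using assms(5) by (simp add: analytic_solution_on_def)
  have "\<forall>\<^sub>F t in at_left T. t \<in> {0<..<T}"
    using eventually_at_left_real[OF assms(4)] .
  then have ev: "\<forall>\<^sub>F t in at_left T. t \<in> {0..<T}"
    by eventually_elim simp
  have limit: "(f \<longlongrightarrow> F T) (at_left T)"
    if F: "real_analytic_on F {0..<T'}" and eq: "\<And>t. t \<in> {0..<T} \<Longrightarrow> F t = f t"
    for F f :: "real \<Rightarrow> (real^3)^'n"
  proof (rule Lim_transform_eventually)
    show "(F \<longlongrightarrow> F T) (at_left T)"
      using real_analytic_on_tendsto[OF F assms(4) \<open>T < T'\<close>] by (rule tendsto_within_subset) simp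
    show "\<forall>\<^sub>F t in at_left T. F t = f t"
      using ev by eventually_elim (simp add: eq)
  qed
  have q_lim: "(q \<longlongrightarrow> Q T) (at_left T)" and p_lim: "(p \<longlongrightarrow> P T) (at_left T)"
    using limit[OF Q] limit[OF P] ext by auto
  have regular: "\<forall>\<^sub>F t in at_left T.
      (\<forall>i. q t $ i \<in> M2 \<kappa>) \<and> q t \<notin> Delta_plus \<kappa> \<union> Delta_minus \<kappa>"
    using ev by eventually_elim (use sol in \<open>simp add: solution_on_def\<close>)
  have QM: "Q T $ i \<in> M2 \<kappa>" for i
  proof (rule Lim_in_closed_set[OF closed_M2])
    show "\<forall>\<^sub>F t in at_left T. q t $ i \<in> M2 \<kappa>"
      using regular by eventually_elim simp
    show "((\<lambda>t. q t $ i) \<longlongrightarrow> Q T $ i) (at_left T)"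
      by (intro tendsto_intros q_lim)
  qed simp

  obtain i0 j0 where ij: "i0 \<noteq> j0" "\<kappa> * odot \<kappa> (Q T $ i0) (Q T $ j0) = 1"
    using collision_pair_in_limit[OF assms(2) _ q_lim assms(7)] by auto
  have not_antipodal: "\<kappa> * odot \<kappa> (Q T $ i) (Q T $ j) \<noteq> -1" if "i \<noteq> j" for i j
  proof (cases "\<kappa> > 0")
    case True
    have "Q T \<notin> Delta_plus \<kappa> \<inter> Delta_minus \<kappa>"
      using limit_not_collision_antipodal[OF assms(6)[OF True] q_lim _ ev] by simp
    moreover have "Q T \<in> Delta_plus \<kappa>"
      unfolding Delta_plus_def mem_Collect_eq using QM ij by blast
    ultimately have "Q T \<notin> Delta_minus \<kappa>"
      by blast
    then show ?thesis
      unfolding Delta_minus_def mem_Collect_eq using QM that by blast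
  next
    case False
    then show ?thesis
      using hyperboloid_odot_ge_1[of \<kappa> "Q T $ i" "Q T $ j"] QM assms(1) by auto
  qed

  define a where "a = Q T $ i0"
  define C where "C = {j. Q T $ j = a}"
  have C: "i0 \<in> C" "j0 \<in> C"
    using M2_eq_if_odot_eq_1[OF assms(1) QM[of i0] QM[of j0]] ij(2) by (auto simp: C_def a_def)
  define L where "L v = (\<Sum>i\<in>C. sgn \<kappa> * \<kappa> * odot \<kappa> (v $ i) a)" for v :: "(real^3)^'n"
  define rate where
    "rate t = (\<Sum>i\<in>C. sgn \<kappa> * \<kappa> * odot \<kappa> (momentum_rate \<kappa> m (q t) (p t) i) a)" for t

  have "bounded_linear L"
    unfolding linear_conv_bounded_linear[symmetric]
    by (rule linearI) (simp_all add: L_def odot_def sum.distrib[symmetric] sum_distrib_left algebra_simps)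
  then obtain D where D: "((\<lambda>t. L (P t)) has_real_derivative D) (at T)"
    using real_analytic_on_differentiable[OF P assms(4) \<open>T < T'\<close>] by blast
  have deriv: "((\<lambda>t. L (P t)) has_real_derivative rate t) (at t)" if t: "0 < t" "t < T" for t
  proof -
    have "at t within {0..<T} = at t"
      using t by (intro at_within_interior) auto
    then have "((\<lambda>s. p s $ i) has_vector_derivative momentum_rate \<kappa> m (q t) (p t) i) (at t)" for i
      using sol t unfolding solution_on_def
      by (metis atLeastLessThan_iff less_imp_le)
    then have "((\<lambda>s. odot \<kappa> (p s $ i) a) has_real_derivative
        odot \<kappa> (momentum_rate \<kappa> m (q t) (p t) i) a) (at t)" for i
      using bounded_linear.has_vector_derivative[OF linear_odot_left[unfolded linear_conv_bounded_linear]]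
      unfolding has_real_derivative_iff_has_vector_derivative by blast
    then have "((\<lambda>s. L (p s)) has_real_derivative rate t) (at t)"
      unfolding L_def rate_def by (intro DERIV_sum DERIV_cmult)
    then show ?thesis
      by (rule has_field_derivative_transform_within_open[of _ _ _ "{0<..<T}"]) (use t ext in auto)
  qed
  have "filterlim rate at_top (at_left T)"
    unfolding rate_def C_def
    by (rule cluster_momentum_rate_at_top[OF assms(1,3) q_lim p_lim regular QM not_antipodal
        C[unfolded C_def] ij(1)])
  from not_differentiable_if_deriv_at_top[OF assms(4) D deriv this] show False .
qed

end
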